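(* Let $n\ge 3$ and let $\Delta_\Gamma(L^\ast_n)$ be the Gallai-simplicial complex of the triangular ladder graph $L^\ast_n$ with $2n$ vertices. Let $N=\dim \Delta_\Gamma(L^\ast_n)$ and let $f_k$ be the number of $k$-dimensional faces of $\Delta_\Gamma(L^\ast_n)$. Then the Euler characteristic of $\Delta_\Gamma(L^\ast_n)$ is $$\chi(\Delta_\Gamma(L^\ast_n))=\sum_{k=0}^N(-1)^k f_k=0.$$
   Context: Triangular ladder graph: the ladder graph $L_n=P_n\times P_2$ is the Cartesian product of the path graphs on $n$ and $2$ vertices (a ladder with $n$ rungs). The triangular ladder graph $L^\ast_n$ is obtained from $L_n$ by adding a cross edge between every two consecutive rungs; it has $2n$ vertices and $4n-3$ edges. Writing $e_{i,j}=\{i,j\}$, it is labelled so that its vertex set is $[2n]=\{1,\dots,2n\}$ and its edge set consists of $e_{i,i+1}$ for $1\le i\le 2n-1$, together with $e_{i,2n-i}$ and $e_{i,2n+1-i}$ for $1\le i\le n-1$. Gallai graph: for a graph $G$, the Gallai graph $\Gamma(G)$ has vertex set $E(G)$, and two distinct edges of $G$ are adjacent in $\Gamma(G)$ if and only if they share an endpoint in $G$ and do not span a triangle in $G$ (i.e. $e_{i,j}$ and $e_{j,k}$ with $i\ne k$ are adjacent in $\Gamma(G)$ iff $\{i,k\}\notin E(G)$). Gallai-indices: for a finite simple graph $G$ with $V(G)=[m]$, the set $\Omega(G)$ of Gallai-indices is the collection of subsets of $V(G)$ consisting of the sets $F_{i,j,k}=\{i,j,k\}$ for all pairs $e_{i,j},e_{j,k}$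 adjacent in $\Gamma(G)$, and the sets $F_{i,j}=\{i,j\}$ for all $e_{i,j}$ that are isolated vertices of $\Gamma(G)$. Gallai-simplicial complex: $\Delta_\Gamma(G)=\langle F \mid F\in\Omega(G)\rangle$ is the simplicial complex on $V(G)$ generated by $\Omega(G)$; its faces are the subsets of elements of $\Omega(G)$. A face $F$ has dimension $|F|-1$ (the empty face, of dimension $-1$, is not counted in the Euler characteristic). *)

theory Defs
  imports Main
begin

text \<open>A graph is a pair of a vertex set and a set of edges, each edge being the two-element
  set of its endpoints.\<close>

type_synonym 'a graph = "'a set \<times> 'a set set"

abbreviation verts :: "'a graph \<Rightarrow> 'a set" where
  "verts G \<equiv> fst G"

abbreviation edges :: "'a graph \<Rightarrow> 'a set set" where
  "edges G \<equiv> snd G"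

definition finite_simple_graph :: "'a graph \<Rightarrow> bool" where
  "finite_simple_graph G \<longleftrightarrow>
     finite (verts G) \<and> (\<forall>e \<in> edges G. e \<subseteq> verts G \<and> card e = 2)"

definition isolated_vertex :: "'a graph \<Rightarrow> 'a \<Rightarrow> bool" where
  "isolated_vertex G v \<longleftrightarrow> v \<in> verts G \<and> (\<forall>e \<in> edges G. v \<notin> e)"

text \<open>The two rails are the paths on \<open>1, \<dots>, n\<close> and on \<open>n + 1, \<dots>, 2 * n\<close>.  The rungs are
  \<open>{i, 2 * n + 1 - i}\<close> for \<open>1 \<le> i \<le> n\<close>; the last of them, \<open>{n, n + 1}\<close>, joins the two rails
  and is listed with the edges \<open>{i, i + 1}\<close>.  The cross edge \<open>{i, 2 * n - i}\<close> joins an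
  end of the \<open>i\<close>-th rung to the opposite end of the next one.\<close>

definition triangular_ladder :: "nat \<Rightarrow> nat graph" where
  "triangular_ladder n =
     ({1..2 * n},
      {{i, i + 1} | i. 1 \<le> i \<and> i \<le> 2 * n - 1} \<union>
      {{i, 2 * n - i} | i. 1 \<le> i \<and> i \<le> n - 1} \<union>
      {{i, 2 * n + 1 - i} | i. 1 \<le> i \<and> i \<le> n - 1})"

definition gallai_graph :: "'a graph \<Rightarrow> 'a set graph" where
  "gallai_graph G =
     (edges G,
      {{{i, j}, {j, k}} | i j k.
         {i, j} \<in> edges G \<and> {j, k} \<in> edges G \<and> i \<noteq> k \<and> {i, k} \<notin> edges G})"

definition gallai_indices :: "'a graph \<Rightarrow> 'a set set" where
  "gallai_indices G =
     {{i, j, k} | i j k. {{i, j}, {j, k}} \<in> edges (gallai_graph G)} \<union>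
     {{i, j} | i j. isolated_vertex (gallai_graph G) {i, j}}"

definition generated_complex :: "'a set set \<Rightarrow> 'a set set" where
  "generated_complex \<F> = {F. \<exists>M \<in> \<F>. F \<subseteq> M}"

definition gallai_complex :: "'a graph \<Rightarrow> 'a set set" where
  "gallai_complex G = generated_complex (gallai_indices G)"

definition face_dim :: "'a set \<Rightarrow> int" where
  "face_dim F = int (card F) - 1"

definition complex_dim :: "'a set set \<Rightarrow> int" where
  "complex_dim \<Delta> = Max (face_dim ` \<Delta>)"

definition num_faces :: "'a set set \<Rightarrow> int \<Rightarrow> nat" where
  "num_faces \<Delta> k = card {F \<in> \<Delta>. face_dim F = k}"

definition euler_characteristic :: "'a set set \<Rightarrow> int" where
  "euler_characteristic \<Delta> =
     (\<Sum>k \<in> {0..complex_dim \<Delta>}. (-1) ^ nat k * int (num_faces \<Delta> k))"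

lemma finite_simple_graph_triangular_ladder: "finite_simple_graph (triangular_ladder n)"
  unfolding finite_simple_graph_def triangular_ladder_def by (auto simp: card_2_iff')

lemma card_verts_triangular_ladder: "card (verts (triangular_ladder n)) = 2 * n"
  by (simp add: triangular_ladder_def)

lemma card_edges_triangular_ladder:
  assumes "n \<ge> 1"
  shows "card (edges (triangular_ladder n)) = 4 * n - 3"
proof -
  let ?A = "(\<lambda>i. {i, i + 1}) ` {1..2 * n - 1}"
  let ?B = "(\<lambda>i. {i, 2 * n - i}) ` {1..n - 1}"
  let ?C = "(\<lambda>i. {i, 2 * n + 1 - i}) ` {1..n - 1}"
  have "edges (triangular_ladder n) = (?A \<union> ?B) \<union> ?C"
    by (auto simp: triangular_ladder_def)
  moreover have "card ?A = 2 * n - 1" "card ?B = n - 1" "card ?C = n - 1"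
    by (subst card_image; force simp: inj_on_def doubleton_eq_iff)+
  moreover have "?A \<inter> ?B = {}" "(?A \<union> ?B) \<inter> ?C = {}"
    by (auto simp: doubleton_eq_iff)
  ultimately show ?thesis
    using assms by (simp add: card_Un_disjoint)
qed

lemma finite_simple_graph_gallai_graph:
  assumes "finite (edges G)"
  shows "finite_simple_graph (gallai_graph G)"
  using assms unfolding finite_simple_graph_def gallai_graph_def
  by (auto simp: card_2_iff' doubleton_eq_iff)

end

theory Submission
  imports Defs
begin

text \<open>List the vertices of the triangular ladder in the zigzag order
  \<open>2n, 1, 2n - 1, 2, \<dots>, n + 1, n\<close>. The edges then join exactly the vertices at distance 1 or 2
  in this order, so the ladder is the square of a path on \<open>m = 2n\<close> vertices. For \<open>m \<ge> 6\<close> no edge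
  is isolated in the Gallai graph, and the facets are the translates of \<open>{0, 1, 3}\<close>, \<open>{0, 2, 3}\<close>
  and \<open>{0, 2, 4}\<close>. Hence the nonempty faces are the translates inside \<open>{0, \<dots>, m - 1}\<close> of eight
  patterns with minimum 0, a pattern with maximum \<open>l\<close> having \<open>m - l\<close> of them, and
  \<open>m - ((m-1) + (m-2) + (m-3) + (m-4)) + (2(m-3) + (m-4)) = 0\<close>.\<close>

section \<open>The Euler characteristic as a signed sum over nonempty faces\<close>

lemma euler_characteristic_eq_sum_faces:
  assumes fin: "finite \<Delta>" and faces: "\<And>F. F \<in> \<Delta> \<Longrightarrow> finite F"
  shows "euler_characteristic \<Delta> = (\<Sum>F \<in> \<Delta> - {{}}. (-1) ^ (card F - 1))"
proof -
  let ?D = "\<Delta> - {{}}"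
  have dim_nonneg: "0 \<le> face_dim F" if "F \<in> ?D" for F
    using that faces[of F] card_gt_0_iff[of F] by (auto simp: face_dim_def)
  have dim_le: "face_dim F \<le> complex_dim \<Delta>" if "F \<in> ?D" for F
    using that fin by (auto simp: complex_dim_def)
  have "(\<Sum>F \<in> ?D. (-1) ^ (card F - 1)) = (\<Sum>F \<in> ?D. (-1 :: int) ^ nat (face_dim F))"
    by (intro sum.cong refl) (auto simp: face_dim_def nat_diff_distrib')
  \<comment> \<open>Group the faces by dimension. Every nonempty face has a dimension between 0 and
    \<open>complex_dim \<Delta>\<close>, so no term is lost.\<close>
  also have "\<dots> = (\<Sum>k \<in> {0..complex_dim \<Delta>}. \<Sum>F \<in> {F \<in> ?D. face_dim F = k}. (-1) ^ nat (face_dim F))"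
    using dim_nonneg dim_le fin
    by (intro sum.group[symmetric]) (simp_all only: finite_Diff image_subset_iff atLeastAtMost_iff, auto)
  also have "\<dots> = (\<Sum>k \<in> {0..complex_dim \<Delta>}. (-1) ^ nat k * int (num_faces \<Delta> k))"
  proof (intro sum.cong refl)
    fix k assume "k \<in> {0..complex_dim \<Delta>}"
    \<comment> \<open>The empty face has dimension -1, outside the range of \<open>k\<close>, so
      restoring it changes no level.\<close>
    then have "{F \<in> ?D. face_dim F = k} = {F \<in> \<Delta>. face_dim F = k}"
      by (auto simp: face_dim_def)
    then show "(\<Sum>F \<in> {F \<in> ?D. face_dim F = k}. (-1) ^ nat (face_dim F))
        = (-1) ^ nat k * int (num_faces \<Delta> k)"
      by (simp add: num_faces_def)
  qed
  finally show ?thesis by (simp add: euler_characteristic_def)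
qed

lemma generated_complex_image:
  "generated_complex ((`) f ` \<F>) = (`) f ` generated_complex \<F>"
  by (auto simp: generated_complex_def subset_image_iff)

lemma generated_complex_subset_Pow: "generated_complex \<F> \<subseteq> Pow (\<Union>\<F>)"
  by (auto simp: generated_complex_def)

text \<open>An injective relabelling of the vertices keeps distinct faces distinct and preserves
  their cardinalities, and the signed sum depends on nothing else. This allows the count to be done
  on positions instead of ladder labels.\<close>

lemma euler_characteristic_image:
  assumes fin: "finite (\<Union>\<Delta>)" and inj: "inj_on f (\<Union>\<Delta>)"
  shows "euler_characteristic ((`) f ` \<Delta>) = euler_characteristic \<Delta>"
proof -
  have sub: "\<Delta> \<subseteq> Pow (\<Union>\<Delta>)" by auto
  have fin\<Delta>: "finite \<Delta>" using fin finite_UnionD by blast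
  have faces: "finite F" "inj_on f F" if "F \<in> \<Delta>" for F
    using that fin inj by (meson Sup_upper finite_subset, meson Sup_upper inj_on_subset)
  have "inj_on ((`) f) (\<Delta> - {{}})"
    using inj_on_subset[OF inj_on_image_Pow[OF inj]] sub by blast
  moreover have "(`) f ` \<Delta> - {{}} = (`) f ` (\<Delta> - {{}})" by auto
  ultimately show ?thesis
    using fin\<Delta> faces
    by (subst (1 2) euler_characteristic_eq_sum_faces) (auto simp: sum.reindex card_image)
qed

section \<open>Gallai-indices read off from the graph\<close>

lemma gallai_indices_eq:
  "gallai_indices G =
     {{i, j, k} | i j k. {i, j} \<in> edges G \<and> {j, k} \<in> edges G \<and> i \<noteq> k \<and> {i, k} \<notin> edges G} \<union>
     {{i, j} | i j. isolated_vertex (gallai_graph G) {i, j}}"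
proof -
  let ?Q = "\<lambda>i j k. {i, j} \<in> edges G \<and> {j, k} \<in> edges G \<and> i \<noteq> k \<and> {i, k} \<notin> edges G"
  have mem: "e \<in> edges (gallai_graph G) \<longleftrightarrow> (\<exists>i j k. e = {{i, j}, {j, k}} \<and> ?Q i j k)" for e
    by (simp add: gallai_graph_def)
  have "{{i, j, k} | i j k. {{i, j}, {j, k}} \<in> edges (gallai_graph G)} = {{i, j, k} | i j k. ?Q i j k}"
    (is "?A = ?B")
  proof
    show "?A \<subseteq> ?B"
    proof
      fix F assume "F \<in> ?A"
      then obtain i j k where F: "F = {i, j, k}" "{{i, j}, {j, k}} \<in> edges (gallai_graph G)"
        by blast
      then obtain i' j' k' where Q: "{{i, j}, {j, k}} = {{i', j'}, {j', k'}}" "?Q i' j' k'"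
        unfolding mem by metis
      \<comment> \<open>The union of the two edges is the triple itself, so \<open>F\<close> does
        not depend on how the edge of the Gallai graph is written.\<close>
      have "F = {i', j', k'}" using arg_cong[OF Q(1), of Union] F(1) by auto
      then show "F \<in> ?B" using Q(2) by blast
    qed
    show "?B \<subseteq> ?A"
    proof
      fix F assume "F \<in> ?B"
      then obtain i j k where F: "F = {i, j, k}" "?Q i j k" by blast
      then have "{{i, j}, {j, k}} \<in> edges (gallai_graph G)" unfolding mem by metis
      then show "F \<in> ?A" using F(1) by blast
    qed
  qed
  then show ?thesis unfolding gallai_indices_def by (simp only:)
qed

section \<open>The triangular ladder as the square of a path\<close>

definition zigzag :: "nat \<Rightarrow> nat \<Rightarrow> nat" where
  "zigzag n a = (if odd a then (a + 1) div 2 else 2 * n - a div 2)"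

lemma inj_on_zigzag: "inj_on (zigzag n) {..<2 * n}"
  unfolding inj_on_def zigzag_def by (auto elim!: oddE evenE split: if_splits)

text \<open>Adjacency in the square of a path. Distance at most 2 is written additively because
  subtraction on \<open>nat\<close> truncates.\<close>

definition near :: "nat \<Rightarrow> nat \<Rightarrow> bool" where
  "near a b \<longleftrightarrow> a \<noteq> b \<and> a \<le> b + 2 \<and> b \<le> a + 2"

lemma near_sym: "near a b \<longleftrightarrow> near b a"
  by (auto simp: near_def)

lemma edges_triangular_ladder:
  "edges (triangular_ladder n) = {{zigzag n a, zigzag n b} | a b. a < 2 * n \<and> b < 2 * n \<and> near a b}"
    (is "?E = ?R")
proof
  show "?E \<subseteq> ?R"
  proof
    fix e assume "e \<in> ?E"
    then consider
        (rail) i where "1 \<le> i" "i \<le> 2 * n - 1" "e = {i, i + 1}"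
      | (cross) i where "1 \<le> i" "i \<le> n - 1" "e = {i, 2 * n - i}"
      | (rung) i where "1 \<le> i" "i \<le> n - 1" "e = {i, 2 * n + 1 - i}"
      by (auto simp: triangular_ladder_def)
    then show "e \<in> ?R"
    proof cases
      case rail
      \<comment> \<open>A label \<open>i \<le> n\<close> sits at the odd position
        \<open>2 * i - 1\<close>, a label \<open>i > n\<close> at the even position
        \<open>2 * (2 * n - i)\<close>. The edge \<open>{n, n + 1}\<close> is the one where the two
        rails meet, at the last two positions.\<close>
      consider "i < n" | "i = n" | "n < i" by linarith
      then show ?thesis
      proof cases
        case 1
        then have "e = {zigzag n (2 * i - 1), zigzag n (2 * i + 1)}"
          using rail by (simp add: zigzag_def)
        moreover have "near (2 * i - 1) (2 * i + 1)" unfolding near_def using rail by linarith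
        moreover have "2 * i - 1 < 2 * n" "2 * i + 1 < 2 * n" using 1 by auto
        ultimately show ?thesis by blast
      next
        case 2
        then have "e = {zigzag n (2 * n - 1), zigzag n (2 * (n - 1))}"
          using rail by (auto simp: zigzag_def)
        moreover have "near (2 * n - 1) (2 * (n - 1))" unfolding near_def using rail 2 by linarith
        moreover have "2 * n - 1 < 2 * n" "2 * (n - 1) < 2 * n" using rail by auto
        ultimately show ?thesis by blast
      next
        case 3
        then have "e = {zigzag n (2 * (2 * n - i)), zigzag n (2 * (2 * n - i - 1))}"
          using rail by (simp add: zigzag_def)
        moreover have "near (2 * (2 * n - i)) (2 * (2 * n - i - 1))"
          unfolding near_def using rail 3 by linarith
        moreover have "2 * (2 * n - i) < 2 * n" "2 * (2 * n - i - 1) < 2 * n" using 3 rail by auto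
        ultimately show ?thesis by blast
      qed
    next
      case cross
      then have "e = {zigzag n (2 * i - 1), zigzag n (2 * i)}"
        by (simp add: zigzag_def)
      moreover have "near (2 * i - 1) (2 * i)" unfolding near_def using cross by linarith
      moreover have "2 * i - 1 < 2 * n" "2 * i < 2 * n" using cross by auto
      ultimately show ?thesis by blast
    next
      case rung
      then have "e = {zigzag n (2 * i - 1), zigzag n (2 * (i - 1))}"
        by (simp add: zigzag_def)
      moreover have "near (2 * i - 1) (2 * (i - 1))" unfolding near_def using rung by linarith
      moreover have "2 * i - 1 < 2 * n" "2 * (i - 1) < 2 * n" using rung by auto
      ultimately show ?thesis by blast
    qed
  qed
next
  \<comment> \<open>Four kinds of pairs arise from the parity of \<open>a\<close> and the distance 1
    or 2: odd distance gives rungs and cross edges, even distance the two rails.\<close>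
  have step: "{zigzag n a, zigzag n b} \<in> ?E" if "a < b" "b \<le> a + 2" "b < 2 * n" for a b
  proof -
    obtain c where "a = 2 * c \<or> a = 2 * c + 1" by (meson oddE evenE)
    moreover have "b = a + 1 \<or> b = a + 2" using that by linarith
    ultimately consider
        (rung) "a = 2 * c" "b = 2 * c + 1" | (low) "a = 2 * c" "b = 2 * c + 2"
      | (cross) "a = 2 * c + 1" "b = 2 * c + 2" | (high) "a = 2 * c + 1" "b = 2 * c + 3"
      by fastforce
    then show ?thesis
    proof cases
      case rung
      then have e: "{zigzag n a, zigzag n b} = {c + 1, 2 * n + 1 - (c + 1)}"
        by (auto simp: zigzag_def)
      show ?thesis
      \<comment> \<open>The rung family stops at \<open>n - 1\<close>; the last rung belongs to the
        family \<open>{i, i + 1}\<close>.\<close>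
      proof (cases "c + 1 = n")
        case True
        then have "{zigzag n a, zigzag n b} = {n, n + 1}" using e by auto
        then show ?thesis using True by (auto simp: triangular_ladder_def)
      next
        case False
        then have "1 \<le> c + 1 \<and> c + 1 \<le> n - 1" using rung that by auto
        then show ?thesis unfolding e triangular_ladder_def snd_conv by blast
      qed
    next
      case low
      then have "{zigzag n a, zigzag n b} = {2 * n - c - 1, (2 * n - c - 1) + 1}"
        using that by (auto simp: zigzag_def)
      moreover have "1 \<le> 2 * n - c - 1 \<and> 2 * n - c - 1 \<le> 2 * n - 1" using low that by auto
      ultimately show ?thesis unfolding triangular_ladder_def snd_conv by blast
    next
      case cross
      then have "{zigzag n a, zigzag n b} = {c + 1, 2 * n - (c + 1)}"
        by (auto simp: zigzag_def)
      moreover have "1 \<le> c + 1 \<and> c + 1 \<le> n - 1" using cross that by auto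
      ultimately show ?thesis unfolding triangular_ladder_def snd_conv by blast
    next
      case high
      then have "{zigzag n a, zigzag n b} = {c + 1, (c + 1) + 1}"
        by (auto simp: zigzag_def)
      moreover have "1 \<le> c + 1 \<and> c + 1 \<le> 2 * n - 1" using high that by auto
      ultimately show ?thesis unfolding triangular_ladder_def snd_conv by blast
    qed
  qed
  show "?R \<subseteq> ?E"
  proof
    fix e assume "e \<in> ?R"
    then obtain a b where ab: "e = {zigzag n a, zigzag n b}" "a < 2 * n" "b < 2 * n" "near a b"
      by blast
    then consider "a < b" | "b < a" unfolding near_def by linarith
    then show "e \<in> ?E"
      using ab step[of a b] step[of b a] by cases (auto simp: near_def insert_commute)
  qed
qed

lemma doubleton_mem_edges_triangular_ladder:
  "{i, j} \<in> edges (triangular_ladder n) \<longleftrightarrow>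
     (\<exists>a b. i = zigzag n a \<and> j = zigzag n b \<and> a < 2 * n \<and> b < 2 * n \<and> near a b)"
  unfolding edges_triangular_ladder by (auto simp: doubleton_eq_iff) (use near_sym in blast)

text \<open>Injectivity recovers the positions from the labels, so both adjacency and non-adjacency
  become statements about \<open>near\<close>.\<close>

lemma zigzag_mem_edges_triangular_ladder:
  assumes "a < 2 * n" "b < 2 * n"
  shows "{zigzag n a, zigzag n b} \<in> edges (triangular_ladder n) \<longleftrightarrow> near a b"
  using assms inj_on_zigzag[of n]
  unfolding doubleton_mem_edges_triangular_ladder inj_on_def by blast

section \<open>Translates of patterns, and the facets\<close>

definition translate :: "nat \<Rightarrow> nat set \<Rightarrow> nat set" where
  "translate a P = (+) a ` P"

lemma translate_insert [simp]: "translate a (insert x P) = insert (a + x) (translate a P)"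
  and translate_empty [simp]: "translate a {} = {}"
  by (simp_all add: translate_def)

text \<open>Since the patterns contain 0, the shift is the least element of the translate;
  membership of each shift in the other translate gives both inequalities.\<close>

lemma translate_inj:
  assumes eq: "translate a P = translate b Q" and "0 \<in> P" "0 \<in> Q"
  shows "a = b \<and> P = Q"
proof -
  have "a \<in> translate a P" "b \<in> translate b Q"
    using assms(2,3) by (force simp: translate_def)+
  then have "a \<in> translate b Q" "b \<in> translate a P" using eq by simp_all
  then have "a = b" by (auto simp: translate_def)
  then show ?thesis using eq inj_image_eq_iff[of "(+) a" P Q] by (auto simp: translate_def)
qed

text \<open>The bound through \<open>Max P\<close> keeps a translate below \<open>m\<close> and
  makes the number of admissible shifts visible as \<open>m - Max P\<close>.\<close>

definition translates :: "nat set set \<Rightarrow> nat \<Rightarrow> nat set set" where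
  "translates \<P> m = {translate a P | a P. P \<in> \<P> \<and> a + Max P < m}"

text \<open>The two gaps are 1 or 2 each, with sum at least 3: the middle vertex is near both ends,
  and the ends are not near each other.\<close>

definition facet_patterns :: "nat set set" where
  "facet_patterns = {{0, 1, 3}, {0, 2, 3}, {0, 2, 4}}"

text \<open>Nonempty subsets of the facet patterns, moved to have least element 0; the gaps of the
  pairs are 1, 2, 3 and 4.\<close>

definition face_patterns :: "nat set set" where
  "face_patterns = {{0}, {0, 1}, {0, 2}, {0, 3}, {0, 4}} \<union> facet_patterns"

lemma mem_translates_facet_patterns:
  "S \<in> translates facet_patterns m \<longleftrightarrow>
     (\<exists>a b c. S = {a, b, c} \<and> c < m \<and>
        (b = a + 1 \<and> c = a + 3 \<or> b = a + 2 \<and> c = a + 3 \<or> b = a + 2 \<and> c = a + 4))"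
proof -
  have "S \<in> translates facet_patterns m \<longleftrightarrow>
      (\<exists>a. \<exists>P \<in> facet_patterns. S = translate a P \<and> a + Max P < m)"
    unfolding translates_def by blast
  also have "\<dots> \<longleftrightarrow> (\<exists>a. S = {a, a + 1, a + 3} \<and> a + 3 < m \<or> S = {a, a + 2, a + 3} \<and> a + 3 < m
        \<or> S = {a, a + 2, a + 4} \<and> a + 4 < m)"
    unfolding facet_patterns_def by simp
  finally show ?thesis by blast
qed

text \<open>In positions, a Gallai-index of three vertices is an induced path \<open>a\<close>,
  \<open>b\<close>, \<open>c\<close> in the square of a path. The bound on \<open>n\<close> gives
  every edge room to extend to such a path, so isolated vertices of the Gallai graph contribute
  nothing.\<close>

lemma gallai_indices_triangular_ladder:
  assumes "n \<ge> 3"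
  shows "gallai_indices (triangular_ladder n) = (`) (zigzag n) ` translates facet_patterns (2 * n)"
    (is "?L = ?R")
proof -
  let ?G = "triangular_ladder n"
  let ?path = "\<lambda>a b c. a < 2 * n \<and> b < 2 * n \<and> c < 2 * n \<and> near a b \<and> near b c \<and> a \<noteq> c \<and> \<not> near a c"
  have path: "{i, j} \<in> edges ?G \<and> {j, k} \<in> edges ?G \<and> i \<noteq> k \<and> {i, k} \<notin> edges ?G \<longleftrightarrow>
      (\<exists>a b c. i = zigzag n a \<and> j = zigzag n b \<and> k = zigzag n c \<and> ?path a b c)" for i j k
  proof
    assume *: "{i, j} \<in> edges ?G \<and> {j, k} \<in> edges ?G \<and> i \<noteq> k \<and> {i, k} \<notin> edges ?G"
    then obtain a b b' c where "i = zigzag n a" "j = zigzag n b" "a < 2 * n" "b < 2 * n" "near a b"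
      "j = zigzag n b'" "k = zigzag n c" "b' < 2 * n" "c < 2 * n" "near b' c"
      unfolding doubleton_mem_edges_triangular_ladder by blast
    moreover from this have "b' = b" using inj_on_zigzag[of n] by (auto simp: inj_on_def)
    ultimately show "\<exists>a b c. i = zigzag n a \<and> j = zigzag n b \<and> k = zigzag n c \<and> ?path a b c"
      using * zigzag_mem_edges_triangular_ladder by blast
  next
    assume "\<exists>a b c. i = zigzag n a \<and> j = zigzag n b \<and> k = zigzag n c \<and> ?path a b c"
    then show "{i, j} \<in> edges ?G \<and> {j, k} \<in> edges ?G \<and> i \<noteq> k \<and> {i, k} \<notin> edges ?G"
      using zigzag_mem_edges_triangular_ladder inj_on_zigzag[of n]
      by (auto simp: inj_on_def)
  qed
  have "\<not> isolated_vertex (gallai_graph ?G) {i, j}" for i j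
  proof
    assume iso: "isolated_vertex (gallai_graph ?G) {i, j}"
    then have "{i, j} \<in> edges ?G" by (simp add: isolated_vertex_def gallai_graph_def)
    then obtain a b where ab: "i = zigzag n a" "j = zigzag n b" "a < 2 * n" "b < 2 * n" "near a b"
      unfolding doubleton_mem_edges_triangular_ladder by blast
    have "\<exists>c. ?path a b c \<or> ?path b a c"
    proof -
      \<comment> \<open>Take \<open>c\<close> three above the lower of the two positions, or else
        three below the higher; with at least six positions one of these exists. As \<open>a\<close>
        and \<open>b\<close> differ by 1 or 2, \<open>c\<close> is within 3 of \<open>a\<close>, and
        the finite list reduces the claim to Presburger arithmetic.\<close>
      have "\<exists>c \<in> {a - 3, a - 2, a - 1, a + 1, a + 2, a + 3}. ?path a b c \<or> ?path b a c"
        using ab assms by (simp add: near_def) presburger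
      then show ?thesis by blast
    qed
    then obtain c where "?path a b c \<or> ?path b a c" by blast
    then have "(\<exists>k. {i, j} \<in> edges ?G \<and> {j, k} \<in> edges ?G \<and> i \<noteq> k \<and> {i, k} \<notin> edges ?G) \<or>
        (\<exists>k. {j, i} \<in> edges ?G \<and> {i, k} \<in> edges ?G \<and> j \<noteq> k \<and> {j, k} \<notin> edges ?G)"
      unfolding path using ab(1,2) by metis
    then have "\<exists>e \<in> edges (gallai_graph ?G). {i, j} \<in> e"
    proof (elim disjE exE)
      fix k
      assume "{i, j} \<in> edges ?G \<and> {j, k} \<in> edges ?G \<and> i \<noteq> k \<and> {i, k} \<notin> edges ?G"
      then have "{{i, j}, {j, k}} \<in> edges (gallai_graph ?G)"
        unfolding gallai_graph_def by auto
      then show ?thesis by blast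
    next
      fix k
      assume "{j, i} \<in> edges ?G \<and> {i, k} \<in> edges ?G \<and> j \<noteq> k \<and> {j, k} \<notin> edges ?G"
      then have "{{j, i}, {i, k}} \<in> edges (gallai_graph ?G)"
        unfolding gallai_graph_def by auto
      then show ?thesis by (metis insertI1 insert_commute)
    qed
    then show False using iso by (auto simp: isolated_vertex_def)
  qed
  then have no_isolated: "{{i, j} | i j. isolated_vertex (gallai_graph ?G) {i, j}} = {}"
    by simp
  have L: "?L = {zigzag n ` {a, b, c} | a b c. ?path a b c}"
    unfolding gallai_indices_eq path no_isolated Un_empty_right image_insert image_empty by blast
  have "{{a, b, c} | a b c. ?path a b c} = translates facet_patterns (2 * n)" (is "?A = ?B")
  proof
    \<comment> \<open>Reversing a path keeps its vertex set, so \<open>a < c\<close> may be assumed.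
      Then \<open>c \<ge> a + 3\<close>, which forces \<open>b\<close> strictly between the
      ends.\<close>
    have sorted: "{a, b, c} \<in> ?B" if p: "?path a b c" and less: "a < c" for a b c
    proof -
      have "b = a + 1 \<and> c = a + 3 \<or> b = a + 2 \<and> c = a + 3 \<or> b = a + 2 \<and> c = a + 4"
        using p less unfolding near_def by linarith
      then show ?thesis
        using p unfolding mem_translates_facet_patterns by blast
    qed
    show "?A \<subseteq> ?B"
    proof
      fix S assume "S \<in> ?A"
      then obtain a b c where S: "S = {a, b, c}" "?path a b c" by blast
      then have "?path c b a" "S = {c, b, a}" by (auto simp: near_def)
      then show "S \<in> ?B" using S sorted[of a b c] sorted[of c b a] by (metis linorder_neqE_nat)
    qed
    show "?B \<subseteq> ?A"
    proof
      fix S assume "S \<in> ?B"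
      then obtain a b c where S: "S = {a, b, c}" "c < 2 * n"
          "b = a + 1 \<and> c = a + 3 \<or> b = a + 2 \<and> c = a + 3 \<or> b = a + 2 \<and> c = a + 4"
        unfolding mem_translates_facet_patterns by blast
      then have "?path a b c" unfolding near_def by linarith
      then show "S \<in> ?A" using S(1) by blast
    qed
  qed
  moreover have "?L = (`) (zigzag n) ` ?A" unfolding L by blast
  ultimately show ?thesis by (simp only:)
qed

section \<open>The nonempty faces\<close>

lemma subset_tripleD:
  assumes "S \<subseteq> {x, y, z}"
  shows "S = {} \<or> S = {x} \<or> S = {y} \<or> S = {z} \<or> S = {x, y} \<or> S = {x, z} \<or> S = {y, z} \<or> S = {x, y, z}"
proof -
  have "S \<in> Pow {x, y, z}" using assms by simp
  then show ?thesis
    by (simp only: Pow_insert Pow_empty image_insert image_empty Un_insert_left Un_insert_right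
        Un_empty_left Un_empty_right insert_iff empty_iff) (elim disjE; simp)
qed

text \<open>Subsets of a facet have few shapes, all among the patterns. The converse needs care at
  the upper end of the positions, where a face must be extended to a facet downwards;
  \<open>m \<ge> 6\<close> leaves room for that.\<close>

lemma generated_complex_facet_patterns:
  assumes "m \<ge> 6"
  shows "generated_complex (translates facet_patterns m) - {{}} = translates face_patterns m"
    (is "?L = ?R")
proof
  show "?L \<subseteq> ?R"
  proof
    fix S assume "S \<in> ?L"
    then obtain T where T: "T \<in> translates facet_patterns m" "S \<subseteq> T" "S \<noteq> {}"
      by (auto simp: generated_complex_def)
    then obtain x y z where xyz: "T = {x, y, z}" "z < m"
        "y = x + 1 \<and> z = x + 3 \<or> y = x + 2 \<and> z = x + 3 \<or> y = x + 2 \<and> z = x + 4"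
      unfolding mem_translates_facet_patterns by blast
    have R: "translate b Q \<in> ?R" if "Q \<in> face_patterns" "b + Max Q < m" for b Q
      using that by (auto simp: translates_def)
    have vertex: "{u} \<in> ?R" if "u < m" for u
      using R[of "{0}" u] that by (simp add: face_patterns_def)
    have edge: "{u, v} \<in> ?R" if "u < v" "v \<le> u + 4" "v < m" for u v
    proof -
      have "v - u \<in> {1, 2, 3, 4}" using that by auto
      then have "{0, v - u} \<in> face_patterns" by (auto simp: face_patterns_def)
      then show ?thesis using R[of "{0, v - u}" u] that by simp
    qed
    have "T \<in> ?R"
      using T(1) by (auto simp: translates_def face_patterns_def)
    moreover have "{x} \<in> ?R" "{y} \<in> ?R" "{z} \<in> ?R" "{x, y} \<in> ?R" "{x, z} \<in> ?R" "{y, z} \<in> ?R"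
      by (rule vertex edge; use xyz in linarith)+
    ultimately show "S \<in> ?R"
      using subset_tripleD[OF T(2)[unfolded xyz(1)]] T(3) xyz(1) by metis
  qed
  show "?R \<subseteq> ?L"
  proof
    fix S assume "S \<in> ?R"
    then obtain a P where P: "P \<in> face_patterns" "a + Max P < m" "S = translate a P"
      by (auto simp: translates_def)
    have F: "S \<in> ?L" if "S \<noteq> {}" "S \<subseteq> translate b Q" "Q \<in> facet_patterns" "b + Max Q < m" for b Q
      using that by (auto simp: generated_complex_def translates_def)
    consider "S = {a}" "a < m" | "S = {a, a + 1}" "a + 1 < m" | "S = {a, a + 2}" "a + 2 < m"
      | "S = {a, a + 3}" "a + 3 < m" | "S = {a, a + 4}" "a + 4 < m" | "P \<in> facet_patterns"
    proof -
      have "P \<in> facet_patterns \<or> P = {0} \<or> P = {0, 1} \<or> P = {0, 2} \<or> P = {0, 3} \<or> P = {0, 4}"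
        using P(1) unfolding face_patterns_def by blast
      then show ?thesis
        using P(2,3) that by (elim disjE) simp_all
    qed
    \<comment> \<open>If \<open>a + 3 < m\<close>, a facet starting at \<open>a\<close> contains the
      vertex or the pair of gap 1 or 2. Otherwise the facet is moved down: \<open>a\<close> becomes
      its top vertex, \<open>{a, a + 1}\<close> the top pair of \<open>{0, 2, 3}\<close>, and
      \<open>{a, a + 2}\<close> the top pair of \<open>{0, 1, 3}\<close>. The equations such as
      \<open>a = (a - 3) + 3\<close> rule out truncation. Pairs of gap 3 or 4 already span a whole
      facet.\<close>
    then show "S \<in> ?L"
    proof cases
      case 1
      show ?thesis
      proof (cases "a + 3 < m")
        case True
        then show ?thesis using 1 F[of a "{0, 1, 3}"] by (auto simp: facet_patterns_def)
      next
        case False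
        then have "a = (a - 3) + 3" using assms by linarith
        then obtain b where "a = b + 3" ..
        then show ?thesis using 1 F[of b "{0, 1, 3}"] by (auto simp: facet_patterns_def)
      qed
    next
      case 2
      show ?thesis
      proof (cases "a + 3 < m")
        case True
        then show ?thesis using 2 F[of a "{0, 1, 3}"] by (auto simp: facet_patterns_def)
      next
        case False
        then have "a = (a - 2) + 2" using assms by linarith
        then obtain b where "a = b + 2" ..
        then show ?thesis using 2 F[of b "{0, 2, 3}"] by (auto simp: facet_patterns_def)
      qed
    next
      case 3
      show ?thesis
      proof (cases "a + 3 < m")
        case True
        then show ?thesis using 3 F[of a "{0, 2, 3}"] by (auto simp: facet_patterns_def)
      next
        case False
        then have "a = (a - 1) + 1" using assms by linarith
        then obtain b where "a = b + 1" ..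
        then show ?thesis using 3 F[of b "{0, 1, 3}"] by (auto simp: facet_patterns_def)
      qed
    next
      case 4
      then show ?thesis using F[of a "{0, 1, 3}"] by (auto simp: facet_patterns_def)
    next
      case 5
      then show ?thesis using F[of a "{0, 2, 4}"] by (auto simp: facet_patterns_def)
    next
      case 6
      then have "S \<noteq> {}" using P by (auto simp: facet_patterns_def)
      then show ?thesis using F[of a P] P 6 by simp
    qed
  qed
qed

section \<open>Counting the faces by pattern\<close>

lemma sum_translates:
  fixes g :: "nat \<Rightarrow> int"
  assumes fin: "finite \<P>" "\<And>P. P \<in> \<P> \<Longrightarrow> 0 \<in> P \<and> finite P"
  shows "(\<Sum>F \<in> translates \<P> m. g (card F)) = (\<Sum>P \<in> \<P>. int (m - Max P) * g (card P))"
proof -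
  have card: "card (translate a P) = card P" for a P
    by (simp add: translate_def card_image)
  \<comment> \<open>A face corresponds to exactly one pair of a pattern and a shift, by
    \<open>translate_inj\<close>. Truncated subtraction gives the empty range of shifts when
    \<open>P\<close> does not fit below \<open>m\<close>.\<close>
  let ?I = "SIGMA P : \<P>. {..<m - Max P}"
  have "translates \<P> m = (\<lambda>(P, a). translate a P) ` ?I"
    unfolding translates_def less_diff_conv[symmetric] by auto
  moreover have "inj_on (\<lambda>(P, a). translate a P) ?I"
  proof (intro inj_onI, clarify)
    fix P a Q b
    assume "P \<in> \<P>" "Q \<in> \<P>" "translate a P = translate b Q"
    then show "P = Q \<and> a = b" using translate_inj fin(2) by blast
  qed
  ultimately have "(\<Sum>F \<in> translates \<P> m. g (card F)) = (\<Sum>(P, a) \<in> ?I. g (card P))"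
    by (simp add: sum.reindex card split_def)
  also have "\<dots> = (\<Sum>P \<in> \<P>. int (m - Max P) * g (card P))"
    using fin by (simp add: sum.Sigma[symmetric])
  finally show ?thesis .
qed

lemma euler_characteristic_facet_patterns:
  assumes "m \<ge> 6"
  shows "euler_characteristic (generated_complex (translates facet_patterns m)) = 0"
    (is "euler_characteristic ?\<Delta> = 0")
proof -
  have "translates facet_patterns m \<subseteq> Pow {..<m}"
    by (auto simp: translates_def facet_patterns_def)
  then have sub: "?\<Delta> \<subseteq> Pow {..<m}" using generated_complex_subset_Pow by blast
  then have "euler_characteristic ?\<Delta> = (\<Sum>F \<in> translates face_patterns m. (-1) ^ (card F - 1))"
    using generated_complex_facet_patterns[OF assms]
    by (subst euler_characteristic_eq_sum_faces)
       (auto intro: finite_subset[OF sub] finite_subset[of _ "{..<m}"])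
  also have "\<dots> = (\<Sum>P \<in> face_patterns. int (m - Max P) * (-1) ^ (card P - 1))"
    by (rule sum_translates[where g = "\<lambda>c. (-1) ^ (c - 1)"])
       (auto simp: face_patterns_def facet_patterns_def)
  also have "\<dots> = 0"
  proof -
    \<comment> \<open>A list without repetitions turns the sum over a set of sets into eight
      explicit terms. As \<open>m \<ge> 6\<close>, no \<open>m - Max P\<close> truncates, and the
      terms cancel.\<close>
    have "face_patterns = set [{0}, {0, 1}, {0, 2}, {0, 3}, {0, 4}, {0, 1, 3}, {0, 2, 3}, {0, 2, 4}]"
      (is "_ = set ?Ps")
      by (auto simp: face_patterns_def facet_patterns_def)
    moreover have "distinct ?Ps" by (simp add: set_eq_subset)
    ultimately have "(\<Sum>P \<in> face_patterns. int (m - Max P) * (-1) ^ (card P - 1))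
        = (\<Sum>P \<leftarrow> ?Ps. int (m - Max P) * (-1) ^ (card P - 1))"
      using sum.distinct_set_conv_list[of ?Ps "\<lambda>P. int (m - Max P) * (-1) ^ (card P - 1)"]
      by metis
    also have "\<dots> = 0" using assms by (simp add: of_nat_diff)
    finally show ?thesis .
  qed
  finally show ?thesis .
qed

theorem theorem3p2:
  fixes n :: nat
  assumes "n \<ge> 3"
  shows "euler_characteristic (gallai_complex (triangular_ladder n)) = 0"
proof -
  let ?\<Delta> = "generated_complex (translates facet_patterns (2 * n))"
  have "translates facet_patterns (2 * n) \<subseteq> Pow {..<2 * n}"
    by (auto simp: translates_def facet_patterns_def)
  \<comment> \<open>\<open>zigzag\<close> is known to be injective only on the positions below
    \<open>2 * n\<close>, so all faces must be placed there before relabelling.\<close>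
  then have sub: "\<Union>?\<Delta> \<subseteq> {..<2 * n}"
    using generated_complex_subset_Pow[of "translates facet_patterns (2 * n)"] by blast
  have "gallai_complex (triangular_ladder n) = (`) (zigzag n) ` ?\<Delta>"
    unfolding gallai_complex_def gallai_indices_triangular_ladder[OF assms]
    by (rule generated_complex_image)
  moreover have "euler_characteristic ((`) (zigzag n) ` ?\<Delta>) = euler_characteristic ?\<Delta>"
    using finite_subset[OF sub] inj_on_subset[OF inj_on_zigzag sub]
    by (intro euler_characteristic_image) auto
  moreover have "euler_characteristic ?\<Delta> = 0"
    using assms by (intro euler_characteristic_facet_patterns) simp
  ultimately show ?thesis by simp
qed

end
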